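(* On any separable C*-algebra $A$, the weakly-uniform topology $\mathrm{wu}$ is weaker than (i.e. contained in) the strict topology.
   Context: $S(A)$ is the state space of $A$ with the weak* topology. For each weak* compact subset $K$ of $S(A)$ let $p_K(a)=\sup_{\varphi\in K}|\varphi(a)|$ for $a\in A$. The weakly-uniform topology $\mathrm{wu}$ is the locally convex topology on $A$ generated by all the seminorms $p_K$, $K$ ranging over the weak* compact subsets of $S(A)$. The strict topology on $A$ is the locally convex topology generated by the seminorms $a\mapsto\|ba\|$ and $a\mapsto\|ab\|$ for $b\in A$. The comparison is on all of $A$, not only on bounded sets, and "weaker" is not meant strictly. *)

theory Defs
  imports "HOL-Analysis.Analysis"
begin

text \<open>
  Complex C*-algebras, not assumed to be unital (nor non-zero).  The underlying real Banach
  algebra is the one of the library; \<open>scaleC\<close> extends its real scalar multiplication.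
\<close>

class cstar_algebra = real_normed_algebra + complete_space +
  fixes scaleC :: "complex \<Rightarrow> 'a \<Rightarrow> 'a"
    and star :: "'a \<Rightarrow> 'a"
  assumes scaleC_add_right: "scaleC c (x + y) = scaleC c x + scaleC c y"
    and scaleC_add_left: "scaleC (c + d) x = scaleC c x + scaleC d x"
    and scaleC_scaleC: "scaleC c (scaleC d x) = scaleC (c * d) x"
    and scaleC_of_real: "scaleC (complex_of_real r) x = scaleR r x"
    and norm_scaleC: "norm (scaleC c x) = cmod c * norm x"
    and mult_scaleC_left: "scaleC c x * y = scaleC c (x * y)"
    and mult_scaleC_right: "x * scaleC c y = scaleC c (x * y)"
    and star_star: "star (star x) = x"
    and star_add: "star (x + y) = star x + star y"
    and star_scaleC: "star (scaleC c x) = scaleC (cnj c) (star x)"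
    and star_mult: "star (x * y) = star y * star x"
    and cstar_identity: "norm (star x * x) = (norm x)\<^sup>2"

definition positive_functional :: "('a::cstar_algebra \<Rightarrow> complex) \<Rightarrow> bool" where
  "positive_functional \<phi> \<longleftrightarrow> (\<forall>a. \<phi> (star a * a) \<in> \<real>\<^sub>\<ge>\<^sub>0)"

text \<open>The norm condition \<open>onorm \<phi> = 1\<close> replaces \<open>\<phi> 1 = 1\<close>, which is not available without a unit.\<close>

definition state_space :: "('a::cstar_algebra \<Rightarrow> complex) set" where
  "state_space = {\<phi>. bounded_linear \<phi> \<and> (\<forall>c x. \<phi> (scaleC c x) = c * \<phi> x) \<and>
     positive_functional \<phi> \<and> onorm \<phi> = 1}"

text \<open>The weak* topology is the topology of pointwise convergence, i.e. the trace of the product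
  topology on the space of all functions from the algebra to the complex numbers.\<close>

definition state_topology :: "('a::cstar_algebra \<Rightarrow> complex) topology" where
  "state_topology = subtopology (product_topology (\<lambda>_. euclidean) UNIV) state_space"

text \<open>The locally convex topology generated by a family of seminorms: basic neighbourhoods of \<open>x\<close>
  are the finite intersections of balls centred at \<open>x\<close>.\<close>

definition seminorm_topology :: "('a::real_vector \<Rightarrow> real) set \<Rightarrow> 'a topology" where
  "seminorm_topology P = topology (\<lambda>U. \<forall>x\<in>U. \<exists>F r. finite F \<and> F \<subseteq> P \<and> 0 < r \<and>
     {y. \<forall>p\<in>F. p (y - x) < r} \<subseteq> U)"

lemma istopology_seminorm:
  "istopology (\<lambda>U. \<forall>x\<in>U. \<exists>F r. finite F \<and> F \<subseteq> P \<and> 0 < r \<and>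
     {y::'a::real_vector. \<forall>p\<in>F. p (y - x) < (r::real)} \<subseteq> U)" (is "istopology ?O")
  unfolding istopology_def
proof (intro conjI allI impI)
  fix S T assume S: "?O S" and T: "?O T"
  show "?O (S \<inter> T)"
  proof
    fix x assume x: "x \<in> S \<inter> T"
    obtain F r where F: "finite F" "F \<subseteq> P" "0 < r" "{y. \<forall>p\<in>F. p (y - x) < r} \<subseteq> S"
      using bspec[OF S IntD1[OF x]] by (elim exE conjE)
    obtain G s where G: "finite G" "G \<subseteq> P" "0 < s" "{y. \<forall>p\<in>G. p (y - x) < s} \<subseteq> T"
      using bspec[OF T IntD2[OF x]] by (elim exE conjE)
    have "finite (F \<union> G)" "F \<union> G \<subseteq> P" "0 < min r s"
      "{y. \<forall>p\<in>F \<union> G. p (y - x) < min r s} \<subseteq> S \<inter> T"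
      using F G by auto
    then show "\<exists>F r. finite F \<and> F \<subseteq> P \<and> 0 < r \<and> {y. \<forall>p\<in>F. p (y - x) < r} \<subseteq> S \<inter> T"
      by (intro exI conjI)
  qed
next
  fix \<K> assume K: "\<forall>K\<in>\<K>. ?O K"
  show "?O (\<Union>\<K>)"
  proof
    fix x assume "x \<in> \<Union>\<K>"
    then obtain S where S: "S \<in> \<K>" "x \<in> S"
      by (rule UnionE)
    obtain F r where F: "finite F" "F \<subseteq> P" "0 < r" "{y. \<forall>p\<in>F. p (y - x) < r} \<subseteq> S"
      using bspec[OF bspec[OF K S(1)] S(2)] by (elim exE conjE)
    have "{y. \<forall>p\<in>F. p (y - x) < r} \<subseteq> \<Union>\<K>"
      by (rule subset_trans[OF F(4) Union_upper[OF S(1)]])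
    with F(1-3) show "\<exists>F r. finite F \<and> F \<subseteq> P \<and> 0 < r \<and> {y. \<forall>p\<in>F. p (y - x) < r} \<subseteq> \<Union>\<K>"
      by (intro exI conjI)
  qed
qed

lemma openin_seminorm_topology:
  "openin (seminorm_topology P) U \<longleftrightarrow> (\<forall>x\<in>U. \<exists>F r. finite F \<and> F \<subseteq> P \<and> 0 < r \<and>
     {y. \<forall>p\<in>F. p (y - x) < r} \<subseteq> U)"
  unfolding seminorm_topology_def topology_inverse'[OF istopology_seminorm] ..

lemma topspace_seminorm_topology [simp]: "topspace (seminorm_topology P) = UNIV"
proof -
  have "openin (seminorm_topology P) UNIV"
    unfolding openin_seminorm_topology by (auto intro!: exI[of _ "{}"] exI[of _ 1])
  from openin_subset[OF this] show ?thesis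
    by (simp add: top.extremum_unique)
qed

text \<open>Inserting 0 only matters for \<open>K = {}\<close>, where the supremum is meant to be 0
  (the real \<open>Sup {}\<close> is an unspecified number).\<close>

definition sup_seminorm :: "('a \<Rightarrow> complex) set \<Rightarrow> 'a \<Rightarrow> real" where
  "sup_seminorm K a = Sup (insert 0 ((\<lambda>\<phi>. cmod (\<phi> a)) ` K))"

definition weakly_uniform_topology :: "'a::cstar_algebra topology" where
  "weakly_uniform_topology = seminorm_topology {sup_seminorm K |K. compactin state_topology K}"

definition strict_topology :: "'a::cstar_algebra topology" where
  "strict_topology = seminorm_topology
     (range (\<lambda>b a. norm (b * a)) \<union> range (\<lambda>b a. norm (a * b)))"

end

theory Submission
  imports Defs
begin

text \<open>
  A weak* compact set \<open>K\<close> of states is tight: there are contractions \<open>e\<close> with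
  \<open>\<bar>\<phi> (y - e * y)\<bar> \<le> \<epsilon> * norm y\<close> for all \<open>\<phi> \<in> K\<close> at once
  (\<open>compact_states_tight\<close>).  In the commutative case \<open>K\<close> is a tight set of probability measures,
  and a function \<open>b\<close> vanishing at infinity slowly enough makes \<open>1 / b\<close> uniformly integrable
  over \<open>K\<close>, so that integrals of \<open>y\<close> are dominated by the supremum of \<open>\<bar>b * y\<bar>\<close>.  In
  general such a \<open>b\<close> comes from Cohen's factorization argument: with suitable \<open>e\<^sub>k\<close>, the elements
  \<open>b\<^sub>n = (\<Sum>k<n. 1/4 * (3/4)^k * e\<^sub>k) + (3/4)^n\<close> of the unitization are invertible, the functionals
  \<open>\<phi> \<circ> b\<^sub>n\<inverse>\<close> stay bounded, and \<open>b\<^sub>n\<close> converges to an element \<open>b\<close> of the algebra itself.  The result,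
  \<open>sup_seminorm K y \<le> 2 * norm (b * y)\<close>, bounds each seminorm of the weakly-uniform topology by
  a multiple of a single strict seminorm.

  Tightness rests on compactness and on a contractive self-adjoint approximate unit.  Every state of
  \<open>K\<close> is almost \<open>1\<close> in modulus on some element of the unit ball, and by compactness finitely many
  elements \<open>x\<^sub>i\<close> suffice for all of \<open>K\<close>.  If \<open>e * x\<^sub>i\<close> is close to every \<open>x\<^sub>i\<close>, the
  Cauchy-Schwarz inequality forces \<open>\<phi> (e * e)\<close> to be close to \<open>1\<close> on \<open>K\<close>, and a second use of
  Cauchy-Schwarz turns this into the uniform estimate above.

  The approximate unit is obtained without spectral theory.  Whenever \<open>1 - g\<close> is
  invertible for a skew-adjoint \<open>g\<close>, the Cayley transform \<open>(1 + g) / (1 - g)\<close> is isometric.  This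
  bounds the inverse of \<open>1 - g\<close> by \<open>1\<close> and carries invertibility from small multiples of \<open>g\<close> to
  all of them.  If
  \<open>v = g / (1 - g)\<close>, then \<open>star v * v = - g\<^sup>2 / (1 - g\<^sup>2)\<close> is the required unit
  when \<open>g\<close> is a large multiple of \<open>\<i> * x * star x\<close>.
\<close>

instance cstar_algebra \<subseteq> banach ..

section \<open>The involution\<close>

lemma star_scaleR: "star (r *\<^sub>R x) = r *\<^sub>R star (x::'a::cstar_algebra)"
  by (metis complex_cnj_complex_of_real scaleC_of_real star_scaleC)

lemma star_minus: "star (- x) = - star (x::'a::cstar_algebra)"
  using star_scaleR[of "-1" x] by simp

lemma star_diff: "star (x - y) = star x - star (y::'a::cstar_algebra)"
  using star_add[of x "- y"] by (simp add: star_minus)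

lemma norm_star [simp]: "norm (star x) = norm (x::'a::cstar_algebra)"
proof -
  have le: "norm y \<le> norm (star y)" for y :: 'a
  proof (cases "y = 0")
    case False
    have "norm y * norm y \<le> norm (star y) * norm y"
      using norm_mult_ineq[of "star y" y] by (simp add: cstar_identity power2_eq_square)
    with False show ?thesis by simp
  qed simp
  show ?thesis using le[of x] le[of "star x"] by (simp add: star_star)
qed

lemma norm_mult_star: "norm (x * star x) = (norm (x::'a::cstar_algebra))\<^sup>2"
  using cstar_identity[of "star x"] by (simp add: star_star)

lemma norm_mult_le_left:
  fixes x y :: "'a::real_normed_algebra"
  assumes "norm x \<le> 1"
  shows "norm (x * y) \<le> norm y"
  using norm_mult_ineq[of x y] mult_right_mono[OF assms, of "norm y"] by simp

lemma norm_mult_le_right: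
  fixes x y :: "'a::real_normed_algebra"
  assumes "norm y \<le> 1"
  shows "norm (x * y) \<le> norm x"
  using norm_mult_ineq[of x y] mult_left_mono[OF assms, of "norm x"] by simp

section \<open>Cayley transforms of skew-adjoint elements\<close>

text \<open>
  Here \<open>v = g / (1 - g)\<close>, so \<open>1 + 2 * v = (1 + g) / (1 - g)\<close> is the Cayley transform of \<open>g\<close>, and
  the equation says \<open>star (1 + 2 * v) * (1 + 2 * v) = 1\<close> without mentioning a unit.  The element
  \<open>d\<close> on its left-hand side is killed by left multiplication with \<open>1 + g\<close>, which is injective
  because \<open>1 + star v = 1 / (1 + g)\<close>.
\<close>

lemma cayley_unitary:
  fixes g v :: "'a::cstar_algebra"
  assumes skew: "star g = - g" and v: "v = g + g * v" and comm: "v * g = g * v"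
  shows "v + star v + 2 *\<^sub>R (star v * v) = 0"
proof -
  define s where "s = star v"
  have sg: "s = - g - s * g"
    using arg_cong[OF v, of star] by (simp add: s_def star_add star_mult skew)
  have "s = - g - g * s"
    using arg_cong[OF v, of star] arg_cong[OF comm, of star]
    by (simp add: s_def star_add star_mult skew)
  then have gs: "g * s = - g - s"
    by (simp add: algebra_simps)
  have gv: "g * v = v - g"
    using v by (simp add: algebra_simps)
  define d where "d = v + s + 2 *\<^sub>R (s * v)"
  have gsv: "g * (s * v) = - (v - g) - s * v"
    using gs gv by (metis mult.assoc left_diff_distrib mult_minus_left)
  have gd: "g * d = - d"
    unfolding d_def by (simp add: distrib_left gsv gv gs algebra_simps scaleR_2)
  have "s * d = - (g * d) - s * (g * d)"
    by (metis sg mult.assoc left_diff_distrib mult_minus_left)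
  then have "d = 0"
    by (simp add: gd)
  then show ?thesis
    by (simp add: d_def s_def)
qed

lemma cayley_isometry:
  fixes v x :: "'a::cstar_algebra"
  assumes u: "v + star v + 2 *\<^sub>R (star v * v) = 0"
  shows "norm (x + 2 *\<^sub>R (v * x)) = norm x"
proof -
  have "star (x + 2 *\<^sub>R (v * x)) * (x + 2 *\<^sub>R (v * x))
      = star x * x + 2 *\<^sub>R (star x * ((v + star v + 2 *\<^sub>R (star v * v)) * x))"
    by (simp add: star_add star_scaleR star_mult algebra_simps)
  then have "(norm (x + 2 *\<^sub>R (v * x)))\<^sup>2 = (norm x)\<^sup>2"
    unfolding u by (simp flip: cstar_identity)
  then show ?thesis by simp
qed

text \<open>
  \<open>1 + v\<close> is the average of \<open>1\<close> and the isometry \<open>1 + 2 * v\<close>.  Since \<open>1 + v = 1 / (1 - g)\<close>,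
  this is the bound by \<open>1\<close> for the resolvent of a skew-adjoint element at \<open>1\<close>.
\<close>

lemma resolvent_contraction:
  fixes v x :: "'a::cstar_algebra"
  assumes "v + star v + 2 *\<^sub>R (star v * v) = 0"
  shows "norm (x + v * x) \<le> norm x"
proof -
  have "norm (2 *\<^sub>R (x + v * x)) = norm (x + (x + 2 *\<^sub>R (v * x)))"
    by (simp add: scaleR_2 algebra_simps)
  also have "\<dots> \<le> norm x + norm x"
    using norm_triangle_ineq[of x "x + 2 *\<^sub>R (v * x)"] by (simp add: cayley_isometry[OF assms])
  finally show ?thesis by simp
qed

lemma cayley_norm_le_1:
  fixes v :: "'a::cstar_algebra"
  assumes "v + star v + 2 *\<^sub>R (star v * v) = 0"
  shows "norm v \<le> 1"
proof -
  have "norm (2 *\<^sub>R (v * star v)) = norm ((star v + 2 *\<^sub>R (v * star v)) - star v)"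
    by simp
  also have "\<dots> \<le> norm v + norm v"
    using norm_triangle_ineq4[of "star v + 2 *\<^sub>R (v * star v)" "star v"]
    by (simp add: cayley_isometry[OF assms])
  finally have "norm v * norm v \<le> 1 * norm v"
    by (simp add: norm_mult_star power2_eq_square)
  then show ?thesis
    by (cases "v = 0") auto
qed

lemma contraction_fixpoint:
  fixes T :: "'a::banach \<Rightarrow> 'a"
  assumes "linear T" "0 \<le> c" "c < 1" "\<And>x. norm (T x) \<le> c * norm x"
  shows "\<exists>x. x = a + T x"
proof -
  have "\<exists>!x. a + T x = x"
    using assms(2-4)
    by (intro banach_fix_type[of c]) (auto simp: dist_norm simp flip: linear_diff[OF assms(1)])
  then show ?thesis by metis
qed

lemma contraction_fixpoint_zero:
  assumes "c < 1" "norm (x::'a::real_normed_vector) \<le> c * norm x"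
  shows "x = 0"
proof (rule ccontr)
  assume "x \<noteq> 0"
  then have "c * norm x < 1 * norm x" using assms(1) by (intro mult_strict_right_mono) auto
  with assms(2) show False by simp
qed

lemma quasi_inverse_small:
  fixes g :: "'a::cstar_algebra"
  assumes "norm g < 1"
  shows "\<exists>v. v = g + g * v \<and> v * g = g * v"
proof -
  obtain v where v: "v = g + g * v"
    using contraction_fixpoint[of "\<lambda>v. g * v" "norm g" g] assms
    by (auto simp: norm_mult_ineq intro!: linearI algebra_simps)
  have "v * g - g * v = g * (v * g - g * v)"
  proof -
    have "v * g = g * g + g * (v * g)" by (metis v distrib_right mult.assoc)
    moreover have "g * v = g * g + g * (g * v)" by (metis v distrib_left)
    ultimately have "v * g - g * v = (g * g + g * (v * g)) - (g * g + g * (g * v))"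
      by (rule arg_cong2)
    also have "\<dots> = g * (v * g - g * v)"
      by (simp add: right_diff_distrib)
    finally show ?thesis .
  qed
  then have "norm (v * g - g * v) \<le> norm g * norm (v * g - g * v)"
    by (metis norm_mult_ineq)
  then have "v * g - g * v = 0"
    using assms by (rule contraction_fixpoint_zero[rotated])
  with v show ?thesis by auto
qed

text \<open>
  From \<open>1 - r * g = r * ((1 - g) - k)\<close> with \<open>k = 1 - 1 / r\<close>, inverting
  \<open>1 - r * g\<close> amounts to inverting \<open>1 - k * (1 + v)\<close>, where \<open>1 + v = 1 / (1 - g)\<close>.
  As \<open>1 + v\<close> has norm at most \<open>1\<close>, a fixed point argument does this as soon as \<open>\<bar>k\<bar> < 1\<close>, that is, for
  \<open>r > 1 / 2\<close>; no bound on the norm of \<open>g\<close> enters.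
\<close>

lemma quasi_inverse_scale:
  fixes g v :: "'a::cstar_algebra"
  assumes skew: "star g = - g" and v: "v = g + g * v" and comm: "v * g = g * v"
    and r: "1 / 2 < r"
  shows "\<exists>w. w = r *\<^sub>R g + r *\<^sub>R g * w \<and> w * (r *\<^sub>R g) = r *\<^sub>R g * w"
proof -
  define k where "k = 1 - 1 / r"
  have k: "\<bar>k\<bar> < 1" and rk: "r - r * k = 1"
    using r by (auto simp: k_def field_simps abs_less_iff)
  have contr: "norm (k *\<^sub>R (x + v * x)) \<le> \<bar>k\<bar> * norm x" for x
    using resolvent_contraction[OF cayley_unitary[OF skew v comm], of x]
    by (simp add: mult_left_mono)
  have inv: "(x + v * x) - g * (x + v * x) = x" for x
  proof -
    have "v * x = g * x + g * (v * x)" by (metis v distrib_right mult.assoc)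
    then show ?thesis by (simp add: algebra_simps)
  qed
  have "linear (\<lambda>w. k *\<^sub>R (w + v * w))"
    by (intro linearI) (simp_all add: algebra_simps)
  then obtain w where w: "w = v + k *\<^sub>R (w + v * w)"
    using contraction_fixpoint[OF _ abs_ge_zero k contr] by blast
  have "w - g * w = (v - g * v) + k *\<^sub>R ((w + v * w) - g * (w + v * w))"
    by (subst (1 2) w) (simp add: algebra_simps)
  moreover have "v - g * v = g"
    using v by (metis add_diff_cancel_right')
  ultimately have "w - g * w = g + k *\<^sub>R w"
    by (simp only: inv)
  then have "r *\<^sub>R (w - g * w) = r *\<^sub>R (g + k *\<^sub>R w)" by simp
  then have "(r - r * k) *\<^sub>R w = r *\<^sub>R g + r *\<^sub>R g * w"
    by (simp add: algebra_simps)
  then have w': "w = r *\<^sub>R g + r *\<^sub>R g * w"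
    by (simp add: rk)
  \<comment> \<open>The commutator satisfies the homogeneous equation \<open>(1 - r * g) * d = 0\<close>, whose only solution
    is \<open>0\<close> by the same contraction estimate.\<close>
  define d where "d = w * g - g * w"
  have "d = r *\<^sub>R (g * d)"
  proof -
    have "w * g = r *\<^sub>R (g * g) + r *\<^sub>R (g * (w * g))"
      using arg_cong[OF w', of "\<lambda>z. z * g"] by (simp add: algebra_simps)
    moreover have "g * w = r *\<^sub>R (g * g) + r *\<^sub>R (g * (g * w))"
      using arg_cong[OF w', of "\<lambda>z. g * z"] by (simp add: algebra_simps)
    ultimately have "d = (r *\<^sub>R (g * g) + r *\<^sub>R (g * (w * g))) - (r *\<^sub>R (g * g) + r *\<^sub>R (g * (g * w)))"
      unfolding d_def by (rule arg_cong2)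
    also have "\<dots> = r *\<^sub>R (g * d)"
      by (simp add: d_def right_diff_distrib scaleR_right_diff_distrib)
    finally show ?thesis .
  qed
  then have "(1 / r) *\<^sub>R d = (1 / r) *\<^sub>R (r *\<^sub>R (g * d))"
    by (rule arg_cong)
  also have "\<dots> = g * d"
    using r by simp
  finally have "(1 / r) *\<^sub>R d = g * d" .
  then have kd: "d - g * d = k *\<^sub>R d"
    by (simp add: k_def algebra_simps)
  have "v * (g * d) = v * d - g * d"
    by (metis v comm add_diff_cancel_left' left_diff_distrib mult.assoc)
  then have "d = (d - g * d) + v * (d - g * d)"
    by (simp add: algebra_simps)
  then have "d = k *\<^sub>R (d + v * d)"
    by (simp add: kd algebra_simps)
  then have "norm d \<le> \<bar>k\<bar> * norm d"
    by (metis contr)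
  then have "d = 0"
    using k by (rule contraction_fixpoint_zero[rotated])
  with w' show ?thesis
    by (intro exI[of _ w]) (auto simp: d_def)
qed

text \<open>
  A small multiple of \<open>g\<close> has a quasi-inverse because multiplication by it is a contraction; repeated scaling by \<open>3 / 2\<close>
  then reaches \<open>g\<close> itself.  This replaces the fact that the spectrum of a skew-adjoint element is
  imaginary.
\<close>

lemma skew_quasi_inverse:
  fixes g :: "'a::cstar_algebra"
  assumes skew: "star g = - g"
  shows "\<exists>v. v = g + g * v \<and> v * g = g * v"
proof -
  have "\<forall>h::'a. star h = - h \<longrightarrow> norm h < (3 / 2) ^ n \<longrightarrow> (\<exists>v. v = h + h * v \<and> v * h = h * v)" for n
  proof (induction n)
    case 0
    then show ?case by (auto intro: quasi_inverse_small)
  next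
    case (Suc n)
    show ?case
    proof (intro allI impI)
      fix h :: 'a assume h: "star h = - h" "norm h < (3 / 2) ^ Suc n"
      define h' where "h' = (2 / 3) *\<^sub>R h"
      have h': "star h' = - h'" "norm h' < (3 / 2) ^ n" "(3 / 2) *\<^sub>R h' = h"
        using h by (auto simp: h'_def star_scaleR)
      obtain v where "v = h' + h' * v" "v * h' = h' * v"
        using Suc h' by blast
      from quasi_inverse_scale[OF h'(1) this, of "3 / 2"] h'(3)
      show "\<exists>v. v = h + h * v \<and> v * h = h * v" by simp
    qed
  qed
  moreover obtain n where "norm g < (3 / 2 :: real) ^ n"
    using real_arch_pow[of "3 / 2" "norm g"] by auto
  ultimately show ?thesis using skew by blast
qed

section \<open>Contractive approximate units\<close>

text \<open>
  With \<open>v = g / (1 - g)\<close> take \<open>e = star v * v\<close>.  By unitarity of the Cayley transform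
  \<open>2 * e = - (v + star v)\<close>, and \<open>(1 + v) * g = v\<close>, \<open>(1 + star v) * g = - star v\<close>, so that
  \<open>2 * (g - e * g) = v - star v\<close>.  The bound is independent of the size of \<open>g\<close>, which makes it
  useful for large multiples of a fixed element.
\<close>

lemma skew_unit:
  fixes g :: "'a::cstar_algebra"
  assumes skew: "star g = - g"
  shows "\<exists>e. star e = e \<and> norm e \<le> 1 \<and> norm (g - e * g) \<le> 1"
proof -
  obtain v where v: "v = g + g * v" and comm: "v * g = g * v"
    using skew_quasi_inverse[OF skew] by blast
  define s where "s = star v"
  note u = cayley_unitary[OF skew v comm, folded s_def]
  have v1: "norm v \<le> 1" "norm s \<le> 1"
    using cayley_norm_le_1[OF cayley_unitary[OF skew v comm]] by (simp_all add: s_def)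
  have sg: "s * g = - g - s"
    using arg_cong[OF v, of star] by (simp add: s_def star_add star_mult skew algebra_simps)
  have vg: "v * g = v - g"
    using v comm by (simp add: algebra_simps)
  define e where "e = s * v"
  have 2: "2 *\<^sub>R e = - (v + s)"
    using u by (simp add: e_def eq_neg_iff_add_eq_0 algebra_simps)
  have "2 *\<^sub>R (g - e * g) = 2 *\<^sub>R g - (2 *\<^sub>R e) * g"
    by (simp add: scaleR_right_diff_distrib)
  also have "(2 *\<^sub>R e) * g = - (v * g + s * g)"
    unfolding 2 by (simp only: mult_minus_left distrib_right)
  also have "2 *\<^sub>R g - - (v * g + s * g) = v - s"
    by (simp add: vg sg scaleR_2)
  finally have "norm (2 *\<^sub>R (g - e * g)) \<le> norm v + norm s"
    by (simp add: norm_triangle_ineq4 del: norm_scaleR)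
  then have "norm (g - e * g) \<le> 1"
    using v1 by simp
  moreover have "star e = e"
    by (simp add: e_def s_def star_mult star_star)
  moreover have "norm e \<le> 1"
    using norm_mult_le_left[of s v] v1 by (simp add: e_def)
  ultimately show ?thesis by blast
qed

lemma approximate_unit_single:
  fixes x :: "'a::cstar_algebra"
  assumes "0 < \<epsilon>"
  shows "\<exists>e. star e = e \<and> norm e \<le> 1 \<and> norm (e * x - x) < \<epsilon>"
proof -
  \<comment> \<open>Applied to \<open>g = \<i> * h / t\<close>, the previous bound becomes \<open>norm (h - e * h) \<le> t\<close>;
    for \<open>h = x * star x\<close> this controls the square of \<open>norm (x - e * x)\<close>.\<close>
  define t where "t = \<epsilon>\<^sup>2 / 4"
  have t: "0 < t" using assms by (simp add: t_def)
  define h where "h = x * star x"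
  define g where "g = (1 / t) *\<^sub>R scaleC \<i> h"
  have "star h = h"
    by (simp add: h_def star_mult star_star)
  moreover have "scaleC (- \<i>) h = - scaleC \<i> h"
    using scaleC_scaleC[of "-1" \<i> h] scaleC_of_real[of "-1" "scaleC \<i> h"] by simp
  ultimately have "star g = - g"
    by (simp add: g_def star_scaleR star_scaleC)
  then obtain e where e: "star e = e" "norm e \<le> 1" "norm (g - e * g) \<le> 1"
    using skew_unit by blast
  have diff: "scaleC \<i> (a - b) = scaleC \<i> a - scaleC \<i> b" for a b :: 'a
    by (metis add_diff_cancel_right' diff_add_cancel scaleC_add_right)
  have "g - e * g = (1 / t) *\<^sub>R scaleC \<i> (h - e * h)"
    by (simp add: g_def diff mult_scaleC_right algebra_simps)
  then have "norm (g - e * g) = norm (h - e * h) / t"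
    using t by (simp add: norm_scaleC)
  with e t have he: "norm (h - e * h) \<le> t"
    by (simp add: field_simps)
  have "(x - e * x) * star (x - e * x) = (h - e * h) - (h - e * h) * e"
    by (simp add: h_def star_diff star_mult e algebra_simps)
  then have "(norm (x - e * x))\<^sup>2 \<le> norm (h - e * h) + norm ((h - e * h) * e)"
    by (metis norm_mult_star norm_triangle_ineq4)
  also have "\<dots> \<le> t + t"
    using he norm_mult_le_right[OF e(2), of "h - e * h"] by simp
  also have "\<dots> < \<epsilon>\<^sup>2"
    using assms by (simp add: t_def)
  finally have "norm (x - e * x) < \<epsilon>"
    using assms by (simp add: power_less_imp_less_base)
  with e show ?thesis
    by (auto simp: norm_minus_commute)
qed

text \<open>
  Approximate units of single elements combine without any order structure.  If \<open>u\<close> serves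
  \<open>F\<close> and \<open>w\<close> serves \<open>x - u * x\<close>, then \<open>z\<close> with \<open>1 - z = (1 - w) * (1 - u)\<close> serves \<open>insert x F\<close>.
  It need be neither contractive nor self-adjoint, but a unit \<open>e\<close> for the single element \<open>z\<close> is both,
  and it inherits the approximation: \<open>e * y\<close> is close to \<open>e * z * y\<close>, hence to \<open>z * y\<close> and to \<open>y\<close>.
\<close>

lemma approximate_unit:
  fixes F :: "'a::cstar_algebra set"
  assumes "finite F" "0 < \<epsilon>"
  shows "\<exists>e. star e = e \<and> norm e \<le> 1 \<and> (\<forall>x\<in>F. norm (e * x - x) < \<epsilon>)"
  using assms
proof (induction F arbitrary: \<epsilon>)
  case empty
  show ?case by (intro exI[of _ 0]) (use star_minus[of "0::'a"] star_diff[of "0::'a" 0] in auto)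
next
  case (insert x F)
  obtain u where u: "norm u \<le> 1" "\<And>y. y \<in> F \<Longrightarrow> norm (u * y - y) < \<epsilon> / 8"
    using insert.IH[of "\<epsilon> / 8"] insert.prems by auto
  obtain w where w: "norm w \<le> 1" "norm (w * (x - u * x) - (x - u * x)) < \<epsilon> / 8"
    using approximate_unit_single[of "\<epsilon> / 8" "x - u * x"] insert.prems by auto
  define z where "z = u + w - w * u"
  have z: "norm (z * y - y) < \<epsilon> / 4" if "y \<in> insert x F" for y
  proof (cases "y = x")
    case True
    have "z * x - x = w * (x - u * x) - (x - u * x)"
      by (simp add: z_def algebra_simps)
    then have "norm (z * x - x) < \<epsilon> / 8"
      using w(2) by (simp only:)
    with True insert.prems show ?thesis by simp
  next
    case False
    have "z * y - y = (u * y - y) - w * (u * y - y)"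
      by (simp add: z_def algebra_simps)
    then have "norm (z * y - y) \<le> norm (u * y - y) + norm (w * (u * y - y))"
      by (metis norm_triangle_ineq4)
    with norm_mult_le_left[OF w(1), of "u * y - y"] u(2)[of y] that False
    show ?thesis by auto
  qed
  \<comment> \<open>Any positive bound of the norms on \<open>insert x F\<close> would do.\<close>
  define B where "B = 1 + (\<Sum>y\<in>insert x F. norm y)"
  have B: "0 < B" "\<And>y. y \<in> insert x F \<Longrightarrow> norm y \<le> B"
    unfolding B_def
     apply (smt (verit) norm_ge_zero sum_nonneg)
    using member_le_sum[of _ "insert x F" norm] insert.hyps(1) by fastforce
  obtain e where e: "star e = e" "norm e \<le> 1" "norm (e * z - z) < \<epsilon> / (2 * B)"
    using approximate_unit_single[of "\<epsilon> / (2 * B)" z] insert.prems B by auto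
  have "norm (e * y - y) < \<epsilon>" if y: "y \<in> insert x F" for y
  proof -
    have split: "e * y - y = (e * z - z) * y + ((z * y - y) - e * (z * y - y))"
      by (simp add: algebra_simps)
    have "norm (e * y - y) \<le> norm ((e * z - z) * y) + norm ((z * y - y) - e * (z * y - y))"
      unfolding split by (rule norm_triangle_ineq)
    moreover have "norm ((z * y - y) - e * (z * y - y)) \<le> norm (z * y - y) + norm (e * (z * y - y))"
      by (rule norm_triangle_ineq4)
    moreover have "norm ((e * z - z) * y) \<le> \<epsilon> / (2 * B) * B"
      using e(3) B(2)[OF y] B(1) insert.prems
      by (intro order_trans[OF norm_mult_ineq] mult_mono) auto
    moreover have "\<epsilon> / (2 * B) * B = \<epsilon> / 2"
      using B(1) by simp
    ultimately show ?thesis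
      using z[OF y] norm_mult_le_left[OF e(2), of "z * y - y"] by linarith
  qed
  with e show ?case by blast
qed

section \<open>States\<close>

text \<open>
  The form \<open>\<phi> (star y * x)\<close> is positive semidefinite.  It is also Hermitian, by polarization: \<open>\<phi>\<close> is
  real at \<open>star a * a\<close> for \<open>a = x + y\<close> and \<open>a = x + \<i> * y\<close>.  The inequality
  then follows by minimizing over \<open>t\<close> the value at \<open>a = x - t * z * y\<close>, where \<open>z = \<phi> (star y * x)\<close>.
\<close>

lemma cauchy_schwarz_positive:
  fixes \<phi> :: "'a::cstar_algebra \<Rightarrow> complex"
  assumes lin: "linear \<phi>" and hom: "\<And>c x. \<phi> (scaleC c x) = c * \<phi> x"
    and pos: "positive_functional \<phi>"
  shows "(cmod (\<phi> (star y * x)))\<^sup>2 \<le> Re (\<phi> (star y * y)) * Re (\<phi> (star x * x))"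
proof -
  have pos': "Re (\<phi> (star a * a)) \<ge> 0" "Im (\<phi> (star a * a)) = 0" for a
    using pos by (auto simp: positive_functional_def complex_nonneg_Reals_iff)
  have expand: "\<phi> (star (x + scaleC c y) * (x + scaleC c y)) =
      \<phi> (star x * x) + c * \<phi> (star x * y) + cnj c * \<phi> (star y * x)
        + cnj c * c * \<phi> (star y * y)" for c
    by (simp add: star_add star_scaleC distrib_left distrib_right mult_scaleC_left
        mult_scaleC_right linear_add[OF lin] hom)
  define z where "z = \<phi> (star y * x)"
  have "Im (\<phi> (star x * y)) + Im z = 0"
    using pos'(2)[of "x + scaleC 1 y"] unfolding expand by (simp add: pos' z_def)
  moreover have "Re (\<phi> (star x * y)) - Re z = 0"
    using pos'(2)[of "x + scaleC \<i> y"] unfolding expand by (simp add: pos' z_def)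
  ultimately have herm: "\<phi> (star x * y) = cnj z"
    by (simp add: complex_eq_iff)
  define X Y W where "X = Re (\<phi> (star x * x))" and "Y = Re (\<phi> (star y * y))"
    and "W = (cmod z)\<^sup>2"
  have quad: "0 \<le> X - 2 * t * W + t\<^sup>2 * W * Y" for t
  proof -
    have W: "z * cnj z = of_real W" "cnj z * z = of_real W"
      using complex_norm_square[of z] by (simp_all add: W_def mult.commute)
    have Y: "\<phi> (star y * y) = of_real Y"
      by (simp add: Y_def complex_eq_iff pos')
    have "\<phi> (star (x + scaleC (- of_real t * z) y) * (x + scaleC (- of_real t * z) y))
        = \<phi> (star x * x) - of_real t * (z * cnj z) - of_real t * (cnj z * z)
          + of_real t * of_real t * (cnj z * z) * of_real Y"
      unfolding expand herm z_def[symmetric] Y by (simp add: algebra_simps)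
    also have "Re \<dots> = X - 2 * t * W + t\<^sup>2 * W * Y"
      unfolding W by (simp add: X_def power2_eq_square)
    finally show ?thesis using pos'(1) by metis
  qed
  have "W \<le> Y * X"
  proof (cases "Y = 0")
    case True
    have "W = 0"
    proof (rule ccontr)
      assume "W \<noteq> 0"
      \<comment> \<open>The quadratic is affine in \<open>t\<close>, and at this \<open>t\<close> its value is \<open>- 1\<close>.\<close>
      then show False using quad[of "(X + 1) / (2 * W)"] True by (simp add: field_simps)
    qed
    then show ?thesis using True by simp
  next
    case False
    then have "0 < Y" using pos'(1)[of y] by (simp add: Y_def)
    then show ?thesis using quad[of "1 / Y"] by (simp add: field_simps power2_eq_square)
  qed
  then show ?thesis by (simp add: W_def X_def Y_def z_def)
qed

lemma state_norm_le:
  assumes "\<phi> \<in> state_space"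
  shows "cmod (\<phi> a) \<le> norm a"
  using assms onorm[of \<phi> a] by (simp add: state_space_def)

lemma state_cauchy_schwarz:
  assumes "\<phi> \<in> state_space"
  shows "(cmod (\<phi> (star y * x)))\<^sup>2 \<le> Re (\<phi> (star y * y)) * (norm x)\<^sup>2"
proof -
  have "(cmod (\<phi> (star y * x)))\<^sup>2 \<le> Re (\<phi> (star y * y)) * Re (\<phi> (star x * x))"
    using assms by (intro cauchy_schwarz_positive) (auto simp: state_space_def bounded_linear.linear)
  also have "\<dots> \<le> Re (\<phi> (star y * y)) * (norm x)\<^sup>2"
  proof (intro mult_left_mono)
    show "Re (\<phi> (star x * x)) \<le> (norm x)\<^sup>2"
      using state_norm_le[OF assms, of "star x * x"] complex_Re_le_cmod[of "\<phi> (star x * x)"]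
      by (simp add: cstar_identity)
    show "0 \<le> Re (\<phi> (star y * y))"
      using assms by (auto simp: state_space_def positive_functional_def complex_nonneg_Reals_iff)
  qed
  finally show ?thesis .
qed

lemma state_norm_almost_attained:
  assumes "\<phi> \<in> state_space" "d < 1"
  shows "\<exists>x. norm x \<le> 1 \<and> d < cmod (\<phi> x)"
proof (rule ccontr)
  assume "\<not> ?thesis"
  then have le: "cmod (\<phi> x) \<le> d" if "norm x \<le> 1" for x
    using that by (meson not_less)
  have lin: "linear \<phi>" and one: "onorm \<phi> = 1"
    using assms by (auto simp: state_space_def bounded_linear.linear)
  have d0: "0 \<le> d" using le[of 0] by (simp add: order_trans[OF norm_ge_zero])
  have "onorm \<phi> \<le> d"
  proof (rule onorm_bound[OF d0])
    fix x
    show "cmod (\<phi> x) \<le> d * norm x"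
    proof (cases "x = 0")
      case False
      have "cmod (\<phi> ((1 / norm x) *\<^sub>R x)) \<le> d" using False by (intro le) simp
      with False show ?thesis by (simp add: linear_scale[OF lin] field_simps)
    qed (simp add: linear_0[OF lin])
  qed
  with one assms(2) show False by simp
qed

text \<open>
  With a unit, Cauchy-Schwarz would give \<open>\<bar>\<phi> ((1 - e) * y)\<bar>\<^sup>2 \<le> \<phi> ((1 - e)\<^sup>2) * (norm y)\<^sup>2\<close> and
  \<open>\<phi> ((1 - e)\<^sup>2) = 1 - 2 * \<phi> e + \<phi> (e * e) \<le> 2 * (1 - \<phi> e)\<close>.  An element \<open>u\<close> of
  the approximate unit that almost fixes both \<open>y\<close> and \<open>e\<close> takes the place of \<open>1\<close>; half of \<open>\<epsilon>\<close>
  pays for the errors.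
\<close>

lemma state_near_one:
  assumes phi: "\<phi> \<in> state_space" and e: "star e = e" "norm e \<le> 1"
    and \<epsilon>: "0 < \<epsilon>" and near: "1 - \<epsilon>\<^sup>2 / 16 \<le> Re (\<phi> e)"
  shows "cmod (\<phi> (y - e * y)) \<le> \<epsilon> * norm y"
proof (cases "y = 0")
  case True
  then show ?thesis using phi linear_0[of \<phi>] by (simp add: state_space_def bounded_linear.linear)
next
  case False
  interpret bounded_linear \<phi> using phi by (simp add: state_space_def)
  define \<delta> where "\<delta> = min (\<epsilon>\<^sup>2 / 16) (\<epsilon> * norm y / 2)"
  have \<delta>: "0 < \<delta>" "\<delta> \<le> \<epsilon>\<^sup>2 / 16" "\<delta> \<le> \<epsilon> * norm y / 2" using False \<epsilon> by (auto simp: \<delta>_def)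
  obtain u where u: "star u = u" "norm u \<le> 1" "norm (u * y - y) < \<delta>" "norm (u * e - e) < \<delta>"
    using approximate_unit[of "{y, e}" \<delta>] \<delta> by auto
  have "star (u * e - e) = e * u - e" by (simp add: star_diff star_mult e u)
  then have eu: "norm (e * u - e) < \<delta>" using u(4) by (metis norm_star)
  have bd: "\<bar>Re (\<phi> z)\<bar> \<le> norm z" for z
    using state_norm_le[OF phi, of z] abs_Re_le_cmod[of "\<phi> z"] by linarith
  have "star (u - e) * (u - e) = u * u + e * e - (u * e - e) - (e * u - e) - 2 *\<^sub>R e"
    by (simp add: star_diff e u algebra_simps scaleR_2)
  then have "Re (\<phi> (star (u - e) * (u - e))) = Re (\<phi> (u * u)) + Re (\<phi> (e * e))
      - Re (\<phi> (u * e - e)) - Re (\<phi> (e * u - e)) - 2 * Re (\<phi> e)"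
    by (simp add: add diff scaleR)
  also have "\<dots> \<le> 1 + 1 + \<delta> + \<delta> - 2 * Re (\<phi> e)"
    using bd[of "u * u"] bd[of "e * e"] bd[of "u * e - e"] bd[of "e * u - e"] u eu e
      norm_mult_le_left[of u u] norm_mult_le_left[of e e] by linarith
  also have "\<dots> \<le> (\<epsilon> / 2)\<^sup>2"
    using near \<delta>(2) by (simp add: power_divide)
  finally have "Re (\<phi> (star (u - e) * (u - e))) * (norm y)\<^sup>2 \<le> (\<epsilon> / 2)\<^sup>2 * (norm y)\<^sup>2"
    by (rule mult_right_mono) simp
  then have "(cmod (\<phi> (star (u - e) * y)))\<^sup>2 \<le> (\<epsilon> / 2 * norm y)\<^sup>2"
    using state_cauchy_schwarz[OF phi, of "u - e" y] unfolding power_mult_distrib by linarith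
  then have "cmod (\<phi> ((u - e) * y)) \<le> \<epsilon> / 2 * norm y"
    using \<epsilon> by (subst (asm) power2_le_iff_abs_le) (auto simp: star_diff u e)
  moreover have "\<phi> (y - e * y) = \<phi> ((u - e) * y) - \<phi> (u * y - y)"
    by (simp add: algebra_simps flip: diff)
  moreover have "cmod (\<phi> (u * y - y)) \<le> \<epsilon> * norm y / 2"
    using state_norm_le[OF phi, of "u * y - y"] u(3) \<delta>(3) by linarith
  ultimately show ?thesis
    using norm_triangle_ineq4[of "\<phi> ((u - e) * y)" "\<phi> (u * y - y)"] by simp
qed

lemma openin_state_topology_gt:
  "openin state_topology {\<phi> \<in> state_space. d < cmod (\<phi> x)}"
proof -
  have "continuous_map state_topology euclidean (\<lambda>\<phi>. \<phi> x)"
    unfolding state_topology_def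
    by (intro continuous_map_from_subtopology continuous_map_product_projection) simp
  then have "openin state_topology {\<phi> \<in> topspace state_topology. \<phi> x \<in> {z. d < cmod z}}"
    by (rule openin_continuous_map_preimage) (simp add: open_Collect_less continuous_on_norm)
  then show ?thesis
    by (simp add: state_topology_def)
qed

text \<open>
  The right-hand condition on the finite set \<open>F\<close> is what the factorization argument asks of its
  approximate units; it is obtained by also letting \<open>w\<close> serve the adjoints of \<open>F\<close>.  The element \<open>w * w\<close>
  is used rather than \<open>w\<close> because \<open>\<bar>\<phi> (w * x)\<bar>\<^sup>2 \<le> \<phi> (w * w)\<close> for \<open>x\<close> in the unit ball, which
  bounds \<open>\<phi> (w * w)\<close> from below.
\<close>

lemma compact_states_tight:
  fixes K :: "('a::cstar_algebra \<Rightarrow> complex) set"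
  assumes K: "compactin state_topology K" and F: "finite F" and \<epsilon>: "0 < \<epsilon>"
  shows "\<exists>e. norm e \<le> 1 \<and> (\<forall>x\<in>F. norm (x * e - x) < \<epsilon>) \<and>
           (\<forall>\<phi>\<in>K. \<forall>y. cmod (\<phi> (y - e * y)) \<le> \<epsilon> * norm y)"
proof -
  define d where "d = min (1 / 2) (\<epsilon>\<^sup>2 / 64)"
  have d: "0 < d" "d \<le> 1 / 2" "d \<le> \<epsilon>\<^sup>2 / 64" using \<epsilon> by (auto simp: d_def)
  have KS: "K \<subseteq> state_space"
    using K by (simp add: state_topology_def compactin_subtopology)
  define U where "U x = {\<phi> \<in> state_space. 1 - d < cmod (\<phi> x)}" for x :: 'a
  have "K \<subseteq> \<Union> (U ` {x. norm x \<le> 1})"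
    using KS state_norm_almost_attained[of _ "1 - d"] d by (fastforce simp: U_def)
  moreover have "\<forall>V \<in> U ` {x. norm x \<le> 1}. openin state_topology V"
    by (auto simp: U_def openin_state_topology_gt)
  ultimately obtain \<V> where "finite \<V>" "\<V> \<subseteq> U ` {x. norm x \<le> 1}" "K \<subseteq> \<Union> \<V>"
    using K unfolding compactin_def by meson
  then obtain X where X: "finite X" "X \<subseteq> {x. norm x \<le> 1}" "K \<subseteq> \<Union> (U ` X)"
    by (metis finite_subset_image)
  obtain w where w: "star w = w" "norm w \<le> 1"
      "\<And>x. x \<in> X \<union> star ` F \<Longrightarrow> norm (w * x - x) < min d (\<epsilon> / 2)"
    using approximate_unit[of "X \<union> star ` F" "min d (\<epsilon> / 2)"] X F \<epsilon> d by auto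
  have e: "star (w * w) = w * w" "norm (w * w) \<le> 1"
    using w norm_mult_le_left[of w w] by (auto simp: star_mult)
  have "norm (x * (w * w) - x) < \<epsilon>" if "x \<in> F" for x
  proof -
    have "star (w * star x - star x) = x * w - x"
      by (simp add: star_diff star_mult star_star w)
    then have xw: "norm (x * w - x) < \<epsilon> / 2"
      using w(3)[of "star x"] that by (metis UnCI imageI min_less_iff_conj norm_star)
    have "x * (w * w) - x = (x * w - x) * w + (x * w - x)"
      by (simp add: algebra_simps)
    then have "norm (x * (w * w) - x) \<le> norm ((x * w - x) * w) + norm (x * w - x)"
      by (metis norm_triangle_ineq)
    with xw norm_mult_le_right[OF w(2), of "x * w - x"] show ?thesis by simp
  qed
  moreover have "cmod (\<phi> (y - w * w * y)) \<le> \<epsilon> * norm y" if phiK: "\<phi> \<in> K" for \<phi> y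
  proof -
    have phi: "\<phi> \<in> state_space" using phiK KS by blast
    interpret bounded_linear \<phi> using phi by (simp add: state_space_def)
    obtain x where x: "x \<in> X" "1 - d < cmod (\<phi> x)"
      using phiK X(3) unfolding U_def by blast
    have "cmod (\<phi> (w * x - x)) < d"
      using state_norm_le[OF phi, of "w * x - x"] w(3)[of x] x by auto
    moreover have "cmod (\<phi> x) \<le> cmod (\<phi> (w * x)) + cmod (\<phi> (w * x - x))"
      using norm_triangle_sub[of "\<phi> x" "\<phi> (w * x)"] by (simp add: diff norm_minus_commute)
    ultimately have "1 - 2 * d \<le> cmod (\<phi> (w * x))"
      using x by linarith
    then have "(1 - 2 * d)\<^sup>2 \<le> (cmod (\<phi> (w * x)))\<^sup>2"
      using d by (intro power_mono) auto
    also have "\<dots> \<le> Re (\<phi> (w * w)) * (norm x)\<^sup>2"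
      using state_cauchy_schwarz[OF phi, of w x] w by simp
    also have "\<dots> \<le> Re (\<phi> (w * w)) * 1"
    proof (intro mult_left_mono)
      show "(norm x)\<^sup>2 \<le> 1" using x X by (auto simp: power_le_one)
      show "0 \<le> Re (\<phi> (w * w))"
        using phi w(1) unfolding state_space_def positive_functional_def complex_nonneg_Reals_iff
        by (metis (mono_tags, lifting) mem_Collect_eq)
    qed
    finally have "(1 - 2 * d)\<^sup>2 \<le> Re (\<phi> (w * w))"
      by simp
    moreover have "1 - 4 * d \<le> (1 - 2 * d)\<^sup>2"
      by (simp add: power2_diff power_mult_distrib)
    ultimately have "1 - \<epsilon>\<^sup>2 / 16 \<le> Re (\<phi> (w * w))"
      using d(3) by linarith
    then show ?thesis
      using state_near_one[OF phi e \<epsilon>] by simp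
  qed
  ultimately show ?thesis
    using e by blast
qed

section \<open>Factorization\<close>

text \<open>
  One step of Cohen's construction, phrased with inequalities instead of inverses.  The element
  \<open>b\<^sub>n = a + (3/4)^n\<close> of the unitization is bounded below by \<open>4^-n\<close> and dominates every \<open>\<phi> \<in> K\<close> with
  constant \<open>2 - 2^-n\<close>.  The new element \<open>b\<^sub>n\<^sub>+\<^sub>1\<close> is close to \<open>b\<^sub>n * f\<close> with
  \<open>f = 3/4 + 1/4 * e\<close>, since their difference \<open>1/4 * (a * e - a)\<close> is small.  Passing from \<open>y\<close> to
  \<open>f * y\<close> at most halves the norm and barely changes \<open>\<phi> y\<close>.  The error \<open>\<delta>\<close> is multiplied by
  at most \<open>3\<close> and by the lower bound's reciprocal \<open>4^(n+1)\<close>, so \<open>3 * \<delta> = 8^-(n+1)\<close> leaves an increase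
  of \<open>2^-(n+1)\<close> in the constant, and these increases have a finite sum.
\<close>

lemma factorization_step:
  fixes a e :: "'a::real_normed_algebra" and K :: "('a \<Rightarrow> 'b::real_normed_vector) set"
  assumes lin: "\<forall>\<phi>\<in>K. linear \<phi>"
    and low: "\<forall>y. norm y \<le> 4 ^ n * norm (a * y + (3 / 4) ^ n *\<^sub>R y)"
    and dom: "\<forall>\<phi>\<in>K. \<forall>y. norm (\<phi> y) \<le> (2 - (1 / 2) ^ n) * norm (a * y + (3 / 4) ^ n *\<^sub>R y)"
    and e: "norm e \<le> 1" "norm (a * e - a) \<le> \<delta>"
      "\<forall>\<phi>\<in>K. \<forall>y. norm (\<phi> (y - e * y)) \<le> \<delta> * norm y"
    and \<delta>: "\<delta> = (1 / 8) ^ Suc n / 3"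
    and a': "a' = a + ((1 / 4) * (3 / 4) ^ n) *\<^sub>R e"
  shows "norm y \<le> 4 ^ Suc n * norm (a' * y + (3 / 4) ^ Suc n *\<^sub>R y)"
    and "\<phi> \<in> K \<Longrightarrow> norm (\<phi> y) \<le> (2 - (1 / 2) ^ Suc n) * norm (a' * y + (3 / 4) ^ Suc n *\<^sub>R y)"
proof -
  \<comment> \<open>This is \<open>3/4 * y + 1/4 * e * y\<close>.\<close>
  define f where "f = y - (1 / 4) *\<^sub>R (y - e * y)"
  define N where "N = norm (a' * y + (3 / 4) ^ Suc n *\<^sub>R y)"
  have \<delta>0: "0 \<le> \<delta>" by (simp add: \<delta>)
  have pw: "(4::real) ^ n > 0" "(4::real) ^ n * (1 / 8) ^ n = (1 / 2) ^ n"
    "(1 / 2) ^ n \<le> (1::real)" "0 < (1 / 2 :: real) ^ n"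
    by (simp_all add: power_le_one flip: power_mult_distrib)
  have d4: "\<delta> * 4 ^ n = (1 / 2) ^ n / 24"
    using pw(2) by (simp add: \<delta> field_simps)
  have "a * f + (3 / 4) ^ n *\<^sub>R f - (a' * y + (3 / 4) ^ Suc n *\<^sub>R y) = (1 / 4) *\<^sub>R ((a * e - a) * y)"
  proof -
    define c :: real where "c = (3 / 4) ^ n"
    have "c *\<^sub>R f = (3 / 4 * c) *\<^sub>R y + (1 / 4 * c) *\<^sub>R (e * y)"
    proof -
      have "c *\<^sub>R y - (1 / 4 * c) *\<^sub>R y = (3 / 4 * c) *\<^sub>R y"
        by (simp flip: scaleR_diff_left)
      then show ?thesis
        by (simp add: f_def scaleR_diff_right mult.commute)
    qed
    moreover have "a * f = a * y + (1 / 4) *\<^sub>R ((a * e - a) * y)"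
      by (simp add: f_def right_diff_distrib left_diff_distrib scaleR_diff_right mult.assoc)
    moreover have "a' * y + (3 / 4) ^ Suc n *\<^sub>R y = a * y + (1 / 4 * c) *\<^sub>R (e * y) + (3 / 4 * c) *\<^sub>R y"
      by (simp add: a' c_def distrib_right)
    ultimately show ?thesis
      unfolding c_def[symmetric] by simp
  qed
  moreover have "norm ((1 / 4) *\<^sub>R ((a * e - a) * y)) \<le> \<delta> * norm y"
    using norm_mult_ineq[of "a * e - a" y] mult_right_mono[OF e(2), of "norm y"]
      mult_nonneg_nonneg[OF \<delta>0 norm_ge_zero[of y]] by simp
  ultimately have Nf: "norm (a * f + (3 / 4) ^ n *\<^sub>R f) \<le> N + \<delta> * norm y"
    unfolding N_def using norm_triangle_sub[of "a * f + (3 / 4) ^ n *\<^sub>R f" "a' * y + (3 / 4) ^ Suc n *\<^sub>R y"]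
    by simp
  have yf: "y = f + (1 / 4) *\<^sub>R (y - e * y)"
    by (simp add: f_def)
  then have "norm y \<le> norm f + norm ((1 / 4) *\<^sub>R (y - e * y))"
    by (metis norm_triangle_ineq)
  moreover have "norm (y - e * y) \<le> norm y + norm (e * y)"
    by (rule norm_triangle_ineq4)
  ultimately have "norm y / 2 \<le> norm f"
    using norm_mult_le_left[OF e(1), of y] by simp
  also have "norm f \<le> 4 ^ n * (N + \<delta> * norm y)"
    by (rule order_trans[OF low[rule_format] mult_left_mono[OF Nf]]) simp
  also have "\<dots> = 4 ^ n * N + (1 / 2) ^ n / 24 * norm y"
    by (simp add: d4[symmetric] distrib_left mult.assoc mult.left_commute)
  also have "\<dots> \<le> 4 ^ n * N + 1 / 24 * norm y"
    using pw by (intro add_left_mono mult_right_mono) auto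
  finally have "norm y / 2 \<le> 4 ^ n * N + 1 / 24 * norm y" .
  moreover have "0 \<le> 4 ^ n * N"
    by (simp add: N_def)
  ultimately have "norm y \<le> 4 * (4 ^ n * N)"
    by linarith
  then have low': "norm y \<le> 4 ^ Suc n * N"
    by simp
  then show "norm y \<le> 4 ^ Suc n * norm (a' * y + (3 / 4) ^ Suc n *\<^sub>R y)"
    by (simp add: N_def)
  assume phi: "\<phi> \<in> K"
  have N0: "0 \<le> N" by (simp add: N_def)
  have "\<phi> (f + (1 / 4) *\<^sub>R (y - e * y)) = \<phi> f + (1 / 4) *\<^sub>R \<phi> (y - e * y)"
    using bspec[OF lin phi] by (simp only: linear_add linear_scale)
  then have "\<phi> y = \<phi> f + (1 / 4) *\<^sub>R \<phi> (y - e * y)"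
    unfolding yf[symmetric] .
  then have "norm (\<phi> y) \<le> norm (\<phi> f) + norm ((1 / 4) *\<^sub>R \<phi> (y - e * y))"
    by (metis norm_triangle_ineq)
  also have "\<dots> \<le> norm (\<phi> f) + \<delta> * norm y"
    using e(3)[rule_format, OF phi, of y] mult_nonneg_nonneg[OF \<delta>0 norm_ge_zero[of y]] by simp
  also have "norm (\<phi> f) \<le> (2 - (1 / 2) ^ n) * (N + \<delta> * norm y)"
    by (rule order_trans[OF dom[rule_format, OF phi] mult_left_mono[OF Nf]]) (use pw in simp)
  also have "(2 - (1 / 2) ^ n) * (N + \<delta> * norm y) \<le> (2 - (1 / 2) ^ n) * N + 2 * (\<delta> * norm y)"
    using \<delta>0 pw by (simp add: distrib_left mult_right_mono)
  also have "(2 - (1 / 2) ^ n) * N + 2 * (\<delta> * norm y) + \<delta> * norm y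
      \<le> (2 - (1 / 2) ^ n) * N + 3 * (\<delta> * (4 ^ Suc n * N))"
    using mult_left_mono[OF low' \<delta>0] by linarith
  also have "3 * (\<delta> * (4 ^ Suc n * N)) = (1 / 2) ^ Suc n * N"
    using arg_cong[OF d4, of "\<lambda>z. 12 * z * N"] by (simp add: algebra_simps)
  finally show "norm (\<phi> y) \<le> (2 - (1 / 2) ^ Suc n) * norm (a' * y + (3 / 4) ^ Suc n *\<^sub>R y)"
    by (simp add: N_def algebra_simps)
qed

lemma convergent_if_geometric_increments:
  fixes a :: "nat \<Rightarrow> 'a::banach"
  assumes "\<bar>c\<bar> < 1" and step: "\<And>n. norm (a (Suc n) - a n) \<le> c ^ n"
  shows "convergent a"
proof -
  have "summable (\<lambda>n. c ^ n)"
    using assms(1) by (simp add: summable_geometric)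
  then have "summable (\<lambda>n. a (Suc n) - a n)"
    by (rule summable_comparison_test') (rule step)
  then have "(\<lambda>n. \<Sum>i<n. a (Suc i) - a i) \<longlonglongrightarrow> (\<Sum>n. a (Suc n) - a n)"
    by (rule summable_LIMSEQ)
  then have "(\<lambda>n. a n - a 0) \<longlonglongrightarrow> (\<Sum>n. a (Suc n) - a n)"
    by (simp only: sum_lessThan_telescope)
  from tendsto_add[OF this tendsto_const[of "a 0"]] show ?thesis
    unfolding convergent_def by (intro exI) simp
qed

text \<open>
  A form of Cohen's factorization theorem: the conclusion says that every \<open>\<phi> \<in> K\<close> is the
  composition of left multiplication by \<open>b\<close> with a linear map of norm at most \<open>2\<close> on the image.  The
  elements \<open>a n\<close> are the parts of \<open>b\<^sub>n = a n + (3/4)^n\<close> inside the algebra; the scalar part tends to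
  \<open>0\<close>, so the uniform constant \<open>2\<close> survives in the limit.
\<close>

lemma factorization_bound:
  fixes K :: "('a::{real_normed_algebra, banach} \<Rightarrow> 'b::real_normed_vector) set"
  assumes lin: "\<And>\<phi>. \<phi> \<in> K \<Longrightarrow> linear \<phi>"
    and bound: "\<And>\<phi> y. \<phi> \<in> K \<Longrightarrow> norm (\<phi> y) \<le> norm y"
    and unit: "\<And>a \<epsilon>. 0 < \<epsilon> \<Longrightarrow> \<exists>e. norm e \<le> 1 \<and> norm (a * e - a) < \<epsilon> \<and>
                 (\<forall>\<phi>\<in>K. \<forall>y. norm (\<phi> (y - e * y)) \<le> \<epsilon> * norm y)"
  shows "\<exists>b. \<forall>\<phi>\<in>K. \<forall>y. norm (\<phi> y) \<le> 2 * norm (b * y)"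
proof -
  define P where "P n a \<longleftrightarrow> (\<forall>y. norm y \<le> 4 ^ n * norm (a * y + (3 / 4) ^ n *\<^sub>R y)) \<and>
      (\<forall>\<phi>\<in>K. \<forall>y. norm (\<phi> y) \<le> (2 - (1 / 2) ^ n) * norm (a * y + (3 / 4) ^ n *\<^sub>R y))"
    for n and a :: 'a
  have "\<exists>a. \<forall>n. P n (a n) \<and> norm (a (Suc n) - a n) \<le> (3 / 4) ^ n"
  proof (rule dependent_nat_choice[of P "\<lambda>n a a'. norm (a' - a) \<le> (3 / 4) ^ n"])
    have "P 0 0"
      unfolding P_def
    proof (intro conjI allI ballI)
      fix \<phi> y assume "\<phi> \<in> K"
      then have "norm (\<phi> y) \<le> norm y" by (rule bound)
      then show "norm (\<phi> y) \<le> (2 - (1 / 2) ^ 0) * norm (0 * y + (3 / 4) ^ 0 *\<^sub>R y)" by simp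
    qed simp
    then show "\<exists>a. P 0 a" ..
  next
    fix a n assume P: "P n a"
    define \<delta> :: real where "\<delta> = (1 / 8) ^ Suc n / 3"
    have "0 < \<delta>" by (simp add: \<delta>_def)
    then obtain e where e: "norm e \<le> 1" "norm (a * e - a) < \<delta>"
        "\<forall>\<phi>\<in>K. \<forall>y. norm (\<phi> (y - e * y)) \<le> \<delta> * norm y"
      using unit[OF \<open>0 < \<delta>\<close>, of a] by (elim exE conjE) (rule that)
    define a' where "a' = a + ((1 / 4) * (3 / 4) ^ n) *\<^sub>R e"
    have "\<forall>\<phi>\<in>K. linear \<phi>"
      using lin by blast
    note step = factorization_step[OF this P[unfolded P_def, THEN conjunct1] P[unfolded P_def, THEN conjunct2]
        e(1) less_imp_le[OF e(2)] e(3) \<delta>_def a'_def]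
    have "P (Suc n) a'"
      unfolding P_def by (intro conjI allI ballI; rule step)
    moreover have "norm (a' - a) \<le> (3 / 4) ^ n"
      using mult_mono[of "1 / 4 * (3 / 4) ^ n :: real" "(3 / 4) ^ n" "norm e" 1] e(1)
      by (simp add: a'_def)
    ultimately show "\<exists>a'. P (Suc n) a' \<and> norm (a' - a) \<le> (3 / 4) ^ n" by blast
  qed
  then obtain a where a: "\<And>n. P n (a n)" "\<And>n. norm (a (Suc n) - a n) \<le> (3 / 4) ^ n"
    by blast
  obtain b where b: "a \<longlonglongrightarrow> b"
    using convergent_if_geometric_increments[of "3 / 4" a] a(2) by (auto simp: convergent_def)
  have "norm (\<phi> y) \<le> 2 * norm (b * y)" if phi: "\<phi> \<in> K" for \<phi> y
  proof (rule LIMSEQ_le_const)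
    have "(\<lambda>n. 2 * norm (a n * y + (3 / 4) ^ n *\<^sub>R y)) \<longlonglongrightarrow> 2 * norm (b * y + 0 *\<^sub>R y)"
      by (intro tendsto_mult tendsto_const tendsto_norm tendsto_add tendsto_scaleR b LIMSEQ_power_zero) simp
    then show "(\<lambda>n. 2 * norm (a n * y + (3 / 4) ^ n *\<^sub>R y)) \<longlonglongrightarrow> 2 * norm (b * y)" by simp
    have "norm (\<phi> y) \<le> 2 * norm (a n * y + (3 / 4) ^ n *\<^sub>R y)" for n
    proof -
      have "norm (\<phi> y) \<le> (2 - (1 / 2) ^ n) * norm (a n * y + (3 / 4) ^ n *\<^sub>R y)"
        by (rule bspec[OF conjunct2[OF a(1)[of n, unfolded P_def]] phi, THEN spec])
      also have "\<dots> \<le> 2 * norm (a n * y + (3 / 4) ^ n *\<^sub>R y)"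
        by (intro mult_right_mono) auto
      finally show ?thesis .
    qed
    then show "\<exists>N. \<forall>n\<ge>N. norm (\<phi> y) \<le> 2 * norm (a n * y + (3 / 4) ^ n *\<^sub>R y)" by simp
  qed
  then show ?thesis by (intro exI[of _ b] ballI allI)
qed

section \<open>Comparison of the topologies\<close>

lemma sup_seminorm_le_left_multiplication:
  fixes K :: "('a::cstar_algebra \<Rightarrow> complex) set"
  assumes K: "compactin state_topology K"
  shows "\<exists>b. \<forall>y. sup_seminorm K y \<le> 2 * norm (b * y)"
proof -
  have KS: "K \<subseteq> state_space"
    using K by (simp add: state_topology_def compactin_subtopology)
  have "\<exists>b. \<forall>\<phi>\<in>K. \<forall>y. norm (\<phi> y) \<le> 2 * norm (b * y)"
  proof (rule factorization_bound)
    fix a :: 'a and \<epsilon> :: real assume "0 < \<epsilon>"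
    then show "\<exists>e. norm e \<le> 1 \<and> norm (a * e - a) < \<epsilon> \<and>
                 (\<forall>\<phi>\<in>K. \<forall>y. norm (\<phi> (y - e * y)) \<le> \<epsilon> * norm y)"
      using compact_states_tight[OF K, of "{a}" \<epsilon>] by simp
  next
    fix \<phi> assume "\<phi> \<in> K"
    then have phi: "\<phi> \<in> state_space" using KS by blast
    then show "linear \<phi>" by (simp add: state_space_def bounded_linear.linear)
    show "norm (\<phi> y) \<le> norm y" for y by (rule state_norm_le[OF phi])
  qed
  then obtain b where b: "\<forall>\<phi>\<in>K. \<forall>y. cmod (\<phi> y) \<le> 2 * norm (b * y)"
    by (elim exE)
  have "sup_seminorm K y \<le> 2 * norm (b * y)" for y
    unfolding sup_seminorm_def
  proof (rule cSup_least)
    fix r assume "r \<in> insert 0 ((\<lambda>\<phi>. cmod (\<phi> y)) ` K)"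
    then show "r \<le> 2 * norm (b * y)"
    proof (elim insertE imageE)
      fix \<phi> assume "r = cmod (\<phi> y)" "\<phi> \<in> K"
      then show ?thesis using bspec[OF b, THEN spec, of \<phi> y] by simp
    qed simp
  qed simp
  then show ?thesis by (intro exI allI)
qed

lemma openin_seminorm_topology_mono:
  assumes dom: "\<And>p. p \<in> P \<Longrightarrow> \<exists>q\<in>Q. \<exists>C>0. \<forall>x. p x \<le> C * q x"
    and U: "openin (seminorm_topology P) U"
  shows "openin (seminorm_topology Q) U"
  unfolding openin_seminorm_topology
proof
  fix x assume xU: "x \<in> U"
  obtain F r where F: "finite F" "F \<subseteq> P" "0 < r" "{y. \<forall>p\<in>F. p (y - x) < r} \<subseteq> U"
    using U[unfolded openin_seminorm_topology, THEN bspec, OF xU] by (elim exE conjE)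
  have "\<forall>p\<in>F. \<exists>w. fst w \<in> Q \<and> 0 < snd w \<and> (\<forall>x. p x \<le> snd w * fst w x)"
  proof
    fix p assume p: "p \<in> F"
    obtain q C where "q \<in> Q" "0 < C" "\<forall>x. p x \<le> C * q x"
      using dom[OF subsetD[OF F(2) p]] by (elim bexE exE conjE)
    then show "\<exists>w. fst w \<in> Q \<and> 0 < snd w \<and> (\<forall>x. p x \<le> snd w * fst w x)"
      by (intro exI[of _ "(q, C)"]) simp
  qed
  from bchoice[OF this] obtain w where
    w: "\<forall>p\<in>F. fst (w p) \<in> Q \<and> 0 < snd (w p) \<and> (\<forall>x. p x \<le> snd (w p) * fst (w p) x)"
    by (elim exE)
  define q C where "q p = fst (w p)" and "C p = snd (w p)" for p
  have q: "q p \<in> Q" "0 < C p" "p x \<le> C p * q p x" if "p \<in> F" for p x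
    using bspec[OF w that] by (simp_all add: q_def C_def)
  define s where "s = Min (insert 1 ((\<lambda>p. r / C p) ` F))"
  have s: "0 < s" "\<And>p. p \<in> F \<Longrightarrow> s \<le> r / C p"
    using F q by (auto simp: s_def)
  have "{y. \<forall>p\<in>q ` F. p (y - x) < s} \<subseteq> {y. \<forall>p\<in>F. p (y - x) < r}"
  proof clarify
    fix y p assume y: "\<forall>p\<in>q ` F. p (y - x) < s" and p: "p \<in> F"
    then have "q p (y - x) < r / C p" using s(2)[OF p] by fastforce
    then have "C p * q p (y - x) < r" using q(2)[OF p] by (simp add: field_simps)
    then show "p (y - x) < r" using q(3)[OF p, of "y - x"] by simp
  qed
  then show "\<exists>F r. finite F \<and> F \<subseteq> Q \<and> 0 < r \<and> {y. \<forall>p\<in>F. p (y - x) < r} \<subseteq> U"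
    using F q(1) s(1) by (intro exI[of _ "q ` F"] exI[of _ s]) auto
qed

theorem proposition3p3:
  assumes "separable_space (euclidean :: 'a::cstar_algebra topology)"
  shows "\<forall>U::'a set. openin weakly_uniform_topology U \<longrightarrow> openin strict_topology U"
proof (intro allI impI)
  fix U :: "'a set"
  assume "openin weakly_uniform_topology U"
  then show "openin strict_topology U"
    unfolding weakly_uniform_topology_def strict_topology_def
  proof (rule openin_seminorm_topology_mono[rotated])
    fix p :: "'a \<Rightarrow> real"
    assume "p \<in> {sup_seminorm K |K. compactin state_topology K}"
    then obtain K where "p = sup_seminorm K" "compactin state_topology K"
      by (elim CollectE exE conjE)
    then obtain b where "\<forall>y. p y \<le> 2 * norm (b * y)"
      by (metis sup_seminorm_le_left_multiplication)
    then show "\<exists>q\<in>range (\<lambda>b a. norm (b * a)) \<union> range (\<lambda>b a. norm (a * b)).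
        \<exists>C>0. \<forall>x. p x \<le> C * q x"
      by (intro bexI[of _ "\<lambda>a. norm (b * a)"] exI[of _ 2]) auto
  qed
qed

end
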